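(* Let $\delta_j=(\delta_{j,0},\dots,\delta_{j,N-1})$, $j\in\mathbb N$, be a sequence in $(0,\infty)^N$ with $\lim_{j\to\infty}\delta_j=0$, and let $y^{\delta_j}=(y_0^{\delta_j},\dots,y_{N-1}^{\delta_j})\in Y^N$ be a corresponding sequence of noisy data satisfying $\|y_i^{\delta_j}-y_i\|\le\delta_{j,i}$ for $i=0,\dots,N-1$, $j\in\mathbb N$. Let $x_k^{\delta_j}$ be the iterates of the loping Levenberg-Marquardt-Kaczmarz iteration with data $y^{\delta_j}$, noise levels $\delta_j$ and initial guess $x_0$, and let $k_*^j:=k_*(\delta_j,y^{\delta_j})$ be the corresponding stopping index. Then $x_{k_*^j}^{\delta_j}$ converges, as $j\to\infty$, to a solution $x^+$ of the system $F_i(x)=y_i$, $i=0,\dots,N-1$. Moreover, if $$\mathcal N(\mathbf F'(x^\dagger))\subseteq\mathcal N(\mathbf F'(x))\quad\text{for all }x\in B_\rho(x_0),$$ where $\mathcal N$ denotes the null space, then $x_{k_*^j}^{\delta_j}$ converges to $x^\dagger$ as $j\to\infty$.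
   Context: Setting. $X,Y$ are Hilbert spaces, $N\ge 1$, $F_i:D_i\subset X\to Y$ for $i=0,\dots,N-1$, and $y_0,\dots,y_{N-1}\in Y$ are exact data. For each $i$ and $x \in D_i$, $F_i'(x):X\to Y$ denotes a bounded linear operator (the "linearization" of $F_i$ at $x$; it need not be the Fréchet derivative). $\mathbf F:=(F_0,\dots,F_{N-1}):\bigcap_i D_i\to Y^N$, $\mathbf F'(x):=(F_0'(x),\dots,F_{N-1}'(x)):X\to Y^N$, $y:=(y_0,\dots,y_{N-1})$. $B_r(z)$ is the open ball of radius $r$ around $z$ in $X$. $[k]:=k \bmod N\in\{0,\dots,N-1\}$. Standing assumptions. (1) $x_0\in X$ and $\rho>0$ satisfy $B_\rho(x_0)\subset\bigcap_{i}D_i$; the maps $F_i$ and $x\mapsto F_i'(x)$ (operator norm) are continuous; there is $C>0$ with $\|F_i'(x)\|\le C$ for all $x\in B_\rho(x_0)$ and all $i$. (2) (Local tangential cone condition) For some $\eta<1$ and all $i$: $\|F_i(\bar x)-F_i(x)-F_i'(x)(\bar x-x)\|\le\eta\|F_i(\bar x)-F_i(x)\|$ for all $x,\bar x\in B_\rho(x_0)$. (3) There is $x^*\in B_{\rho/2}(x_0)$ with $\mathbf F(x^* )=y$. (4) The constants $\alpha,\tau,q$ satisfy $0<q<1$, $\alpha>\frac{C^2q}{1-q}$, $\tau>\frac{1+\eta}{1-\eta}>1$, and $\eta+(1+\eta)\tau^{-1}<q<1$. Loping Levenberg-Marquardt-Kaczmarz iteration. Given noise levels $\delta=(\delta_0,\dots,\delta_{N-1})$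 and data $y^\delta=(y_0^\delta,\dots,y_{N-1}^\delta)$ with $\|y_i^\delta-y_i\|\le\delta_i$, set $x_0^\delta=x_0$ and $x_{k+1}^\delta=x_k^\delta+\omega_kh_k$, where $h_k:=(F_{[k]}'(x_k^\delta)^*F_{[k]}'(x_k^\delta)+\alpha I)^{-1}F_{[k]}'(x_k^\delta)^*(y_{[k]}^\delta-F_{[k]}(x_k^\delta))$, and $\omega_k:=1$ if $\|F_{[k]}(x_k^\delta)-y_{[k]}^\delta\|\ge\tau\delta_{[k]}$, $\omega_k:=0$ otherwise. The stopping index is $k_*^\delta = k_*(\delta,y^\delta):=\min\{lN: l\in\mathbb N,\ x_{lN}^\delta=x_{lN+1}^\delta=\dots=x_{lN+N}^\delta\}$ (with $l=0$ allowed); it is finite when all $\delta_i>0$. $x^\dagger$ denotes the $x_0$-minimal norm solution in $B_{\rho/2}(x_0)$, i.e. the element $x^\dagger\in B_{\rho/2}(x_0)$ with $\mathbf F(x^\dagger)=y$ and $\|x^\dagger-x_0\|=\inf\{\|x-x_0\|: x\in B_{\rho/2}(x_0),\ \mathbf F(x)=y\}$ (which exists under the assumptions above). *)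

theory Defs
  imports "HOL-Analysis.Analysis"
begin

text \<open>Real Hilbert spaces are types of sort \<open>{real_inner, complete_space}\<close>. The component maps
  \<open>F i\<close>, the linearizations \<open>F' i x\<close> and the data \<open>y i\<close> are indexed by natural numbers, of which
  only \<open>i < N\<close> are ever used; \<open>F i\<close> and \<open>F' i\<close> are total functions, of which only the values
  on \<open>D i\<close> carry meaning.\<close>

definition is_solution ::
  "nat \<Rightarrow> (nat \<Rightarrow> 'a set) \<Rightarrow> (nat \<Rightarrow> 'a \<Rightarrow> 'b) \<Rightarrow> (nat \<Rightarrow> 'b) \<Rightarrow> 'a \<Rightarrow> bool"
  where "is_solution N D F y x \<longleftrightarrow> (\<forall>i<N. x \<in> D i \<and> F i x = y i)"

definition is_min_norm_solution ::
  "nat \<Rightarrow> (nat \<Rightarrow> 'a::real_normed_vector set) \<Rightarrow> (nat \<Rightarrow> 'a \<Rightarrow> 'b) \<Rightarrow> (nat \<Rightarrow> 'b)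
    \<Rightarrow> 'a \<Rightarrow> real \<Rightarrow> 'a \<Rightarrow> bool"
  where "is_min_norm_solution N D F y x0 \<rho> x \<longleftrightarrow>
    x \<in> ball x0 (\<rho>/2) \<and> is_solution N D F y x \<and>
    norm (x - x0) = (INF z\<in>{z \<in> ball x0 (\<rho>/2). is_solution N D F y z}. norm (z - x0))"

text \<open>Null space of \<open>h \<mapsto> (A 0 h, \<dots>, A (N - 1) h)\<close>.\<close>

definition joint_null_space ::
  "nat \<Rightarrow> (nat \<Rightarrow> 'a::real_normed_vector \<Rightarrow>\<^sub>L 'b::real_normed_vector) \<Rightarrow> 'a set"
  where "joint_null_space N A = {h. \<forall>i<N. blinfun_apply (A i) h = 0}"

text \<open>\<open>lm_step \<alpha> A r\<close> is \<open>(A* A + \<alpha> I)\<^sup>-\<^sup>1 A* r\<close>. Both \<open>adjoint\<close> and \<open>inv\<close> are Hilbert choices,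
  determined here because \<open>A\<close> is bounded between Hilbert spaces and \<open>\<alpha> > 0\<close>.\<close>

definition lm_step ::
  "real \<Rightarrow> ('a::{real_inner, complete_space} \<Rightarrow>\<^sub>L 'b::{real_inner, complete_space}) \<Rightarrow> 'b \<Rightarrow> 'a"
  where "lm_step \<alpha> A r =
    inv (\<lambda>h. adjoint (blinfun_apply A) (blinfun_apply A h) + \<alpha> *\<^sub>R h) (adjoint (blinfun_apply A) r)"

primrec lmk_iterate ::
  "nat \<Rightarrow> (nat \<Rightarrow> 'a::{real_inner, complete_space} \<Rightarrow> 'b::{real_inner, complete_space})
    \<Rightarrow> (nat \<Rightarrow> 'a \<Rightarrow> 'a \<Rightarrow>\<^sub>L 'b) \<Rightarrow> real \<Rightarrow> real \<Rightarrow> 'a \<Rightarrow> (nat \<Rightarrow> real) \<Rightarrow> (nat \<Rightarrow> 'b) \<Rightarrow> nat \<Rightarrow> 'a"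
  where
    "lmk_iterate N F F' \<alpha> \<tau> x0 \<delta> yd 0 = x0"
  | "lmk_iterate N F F' \<alpha> \<tau> x0 \<delta> yd (Suc k) =
      (let x = lmk_iterate N F F' \<alpha> \<tau> x0 \<delta> yd k;
           i = k mod N;
           h = lm_step \<alpha> (F' i x) (yd i - F i x);
           \<omega> = (if norm (F i x - yd i) \<ge> \<tau> * \<delta> i then 1 else 0)
       in x + \<omega> *\<^sub>R h)"

text \<open>\<open>LEAST\<close> is unspecified if no such index exists; for the iteration above one exists
  whenever all noise levels are positive.\<close>

definition stopping_index :: "nat \<Rightarrow> (nat \<Rightarrow> 'a) \<Rightarrow> nat"
  where "stopping_index N x = (LEAST k. \<exists>l. k = l * N \<and> (\<forall>m\<le>N. x (l * N + m) = x (l * N)))"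

end

theory Submission
  imports Defs
begin

text \<open>
  Writing \<open>p = r - A h\<close> for the linearized residual after a step, \<open>\<alpha> h = A* p\<close>; together with the tangential
  cone condition this makes the distance to every solution in the ball nonincreasing, with a gain
  proportional to the squared residual at each performed step. For exact data the residuals are therefore
  square summable, and comparing with the cycle of least total residual shows that the iterates at the ends
  of the cycles are Cauchy; their limit \<open>xplus\<close> is a solution.

  For noisy data and a fixed number of steps the iterates depend continuously on the data. If
  infinitely many stopping indices equal \<open>l * N\<close>, the exact iterate at \<open>l * N\<close> is already a solution, hence
  equal to \<open>xplus\<close>; if the stopping index is large, monotonicity towards \<open>xplus\<close> allows one to compare with
  a fixed earlier index instead.

  Every update lies in the range of some \<open>A*\<close>, so under the null space condition \<open>xplus - x0\<close> is
  orthogonal to the null space \<open>K\<close> at the minimal norm solution \<open>xdag\<close>. So is \<open>xdag - x0\<close>, by minimality,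
  whereas \<open>xplus - xdag\<close> lies in \<open>K\<close> by the cone condition; hence \<open>xplus = xdag\<close>.
\<close>

section \<open>Regularized least squares in Hilbert spaces\<close>

text \<open>First-order condition at an interior minimum: if \<open>a\<close> were nonzero, a small
  \<open>t\<close> of the opposite sign would let the linear term dominate. Restricting to small
  \<open>t\<close> makes this usable for minimizers on an open ball as well.\<close>

lemma linear_coeff_eq_0_if_quadratic_nonneg:
  fixes a b :: real
  assumes "\<And>t. \<bar>t\<bar> < 1 \<Longrightarrow> 0 \<le> a * t + b * t\<^sup>2"
  shows "a = 0"
proof (rule ccontr)
  assume "a \<noteq> 0"
  define s where "s = 1 / (2 * (1 + \<bar>a\<bar> + \<bar>b\<bar>))"
  have s: "0 < s" "s * \<bar>a\<bar> < 1" "s * \<bar>b\<bar> < 1"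
    by (auto simp: s_def divide_simps)
  have "0 \<le> a * (- s * a) + b * (- s * a)\<^sup>2"
    using assms[of "- s * a"] s by (simp add: abs_mult)
  also have "\<dots> = s * a\<^sup>2 * (s * b - 1)"
    by (simp add: algebra_simps power2_eq_square)
  also have "\<dots> < 0"
  proof -
    have "s * b \<le> s * \<bar>b\<bar>"
      using s(1) by (intro mult_left_mono) auto
    then show ?thesis
      using s \<open>a \<noteq> 0\<close> by (intro mult_pos_neg) (simp, linarith)
  qed
  finally show False by simp
qed

text \<open>The solution is the minimizer of
  \<open>v \<mapsto> \<alpha> (v \<bullet> v) + A v \<bullet> A v - 2 \<phi> v\<close>; by the parallelogram law every minimizing sequence is Cauchy.\<close>

lemma variational_equation_solvable:
  fixes A :: "'a::{real_inner, complete_space} \<Rightarrow> 'b::real_inner" and \<phi> :: "'a \<Rightarrow> real"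
  assumes A: "bounded_linear A" and \<phi>: "bounded_linear \<phi>" and \<alpha>: "\<alpha> > 0"
  shows "\<exists>h. \<forall>v. \<alpha> * (h \<bullet> v) + A h \<bullet> A v = \<phi> v"
proof -
  interpret A: bounded_linear A by fact
  interpret \<phi>: bounded_linear \<phi> by fact
  define J where "J v = \<alpha> * (v \<bullet> v) + A v \<bullet> A v - 2 * \<phi> v" for v
  define m where "m = Inf (range J)"
  obtain K where K: "\<And>v. norm (\<phi> v) \<le> norm v * K"
    using \<phi>.bounded by blast
  have "- K\<^sup>2 / \<alpha> \<le> J v" for v
  proof -
    \<comment> \<open>Completing the square in \<open>norm v\<close> yields the lower bound for
      \<open>J\<close>.\<close>
    have "0 \<le> (\<alpha> * norm v - K)\<^sup>2 / \<alpha>"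
      using \<alpha> by simp
    also have "\<dots> = \<alpha> * (norm v)\<^sup>2 - 2 * (norm v * K) + K\<^sup>2 / \<alpha>"
      using \<alpha> by (simp add: field_simps power2_eq_square)
    also have "\<dots> \<le> J v + K\<^sup>2 / \<alpha>"
      using abs_ge_self[of "\<phi> v"] K[of v] inner_ge_zero[of "A v"] unfolding J_def power2_norm_eq_inner
      real_norm_def by linarith
    finally show ?thesis by simp
  qed
  then have bdd: "bdd_below (range J)"
    by (intro bdd_belowI[of _ "- K\<^sup>2 / \<alpha>"]) auto
  have m_le: "m \<le> J v" for v
    unfolding m_def using bdd by (intro cInf_lower) auto
  have parallelogram: "\<alpha> / 2 * (norm (u - v))\<^sup>2 \<le> J u + J v - 2 * m" for u v
  proof -
    \<comment> \<open>The midpoint is used because its value of \<open>J\<close> is at least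
      \<open>m\<close>, which turns the parallelogram identity into an estimate.\<close>
    have "J u + J v - 2 * J ((1/2) *\<^sub>R (u + v)) =
        \<alpha> / 2 * (norm (u - v))\<^sup>2 + (norm (A u - A v))\<^sup>2 / 2"
      unfolding J_def power2_norm_eq_inner
      by (simp add: A.add A.scaleR \<phi>.add \<phi>.scaleR algebra_simps inner_commute)
        (simp add: field_simps)
    then show ?thesis
      using m_le[of "(1/2) *\<^sub>R (u + v)"] by (smt (verit) zero_le_power2 divide_nonneg_pos)
  qed
  have "\<exists>v. J v < m + inverse (Suc n)" for n
  proof -
    have "Inf (range J) < m + inverse (Suc n)"
      by (simp add: m_def)
    then show ?thesis
      using cInf_lessD[of "range J"] by blast
  qed
  then obtain u where u: "\<And>n. J (u n) < m + inverse (Suc n)"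
    by metis
  have "Cauchy u"
  proof (rule metric_CauchyI)
    fix e :: real
    assume "0 < e"
    then obtain M where M: "inverse (Suc M) < \<alpha> / 4 * e\<^sup>2"
      using reals_Archimedean[of "\<alpha> / 4 * e\<^sup>2"] \<alpha> by auto
    have *: "J (u n) < m + \<alpha> / 4 * e\<^sup>2" if "n \<ge> M" for n
    proof -
      have "inverse (real (Suc n)) \<le> inverse (real (Suc M))"
        using that by (intro le_imp_inverse_le) auto
      then show ?thesis using u[of n] M by linarith
    qed
    have "dist (u a) (u b) < e" if "a \<ge> M" "b \<ge> M" for a b
    proof -
      have "\<alpha> / 2 * (norm (u a - u b))\<^sup>2 < \<alpha> / 2 * e\<^sup>2"
        using parallelogram[of "u a" "u b"] *[of a] *[of b] that by linarith
      then have "(norm (u a - u b))\<^sup>2 < e\<^sup>2"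
        using \<alpha> by simp
      then show ?thesis
        using \<open>0 < e\<close> by (simp add: dist_norm power_less_imp_less_base)
    qed
    then show "\<exists>M. \<forall>a\<ge>M. \<forall>b\<ge>M. dist (u a) (u b) < e" by blast
  qed
  then obtain h where h: "u \<longlonglongrightarrow> h"
    using Cauchy_convergent_iff convergent_def by blast
  have "(\<lambda>n. J (u n)) \<longlonglongrightarrow> J h"
    unfolding J_def by (intro tendsto_intros A.tendsto \<phi>.tendsto h)
  moreover have "(\<lambda>n. m + inverse (real (Suc n))) \<longlonglongrightarrow> m + 0"
    by (intro tendsto_intros LIMSEQ_inverse_real_of_nat)
  ultimately have "J h \<le> m + 0"
    using u by (intro LIMSEQ_le) (auto intro: less_imp_le)
  have "\<alpha> * (h \<bullet> v) + A h \<bullet> A v - \<phi> v = 0" for v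
  proof -
    \<comment> \<open>Comparison of \<open>h\<close> with \<open>h + t *\<^sub>R v\<close>; the
      coefficient of \<open>t\<close> is twice the defect in the variational equation.\<close>
    have "0 \<le> (2 * (\<alpha> * (h \<bullet> v) + A h \<bullet> A v - \<phi> v)) * t + (\<alpha> * (v \<bullet> v) + A v \<bullet> A v) * t\<^sup>2" for t
    proof -
      have "J h \<le> J (h + t *\<^sub>R v)"
        using \<open>J h \<le> m + 0\<close> m_le[of "h + t *\<^sub>R v"] by simp
      then show ?thesis
        unfolding J_def
        by (simp add: A.add A.scaleR \<phi>.add \<phi>.scaleR algebra_simps inner_commute power2_eq_square)
    qed
    then show ?thesis
      using linear_coeff_eq_0_if_quadratic_nonneg by force
  qed
  then show ?thesis by (metis eq_iff_diff_eq_0)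
qed

text \<open>Riesz representation, the case of zero operator and \<open>\<alpha> = 1\<close> of the
  variational equation, produces an adjoint; hence the Hilbert choice in \<open>adjoint\<close>
  selects a genuine one.\<close>

lemma inner_adjoint_blinfun:
  fixes A :: "'a::{real_inner, complete_space} \<Rightarrow>\<^sub>L 'b::real_inner"
  shows "A x \<bullet> y = x \<bullet> adjoint A y"
proof -
  have "\<exists>h. \<forall>x. A x \<bullet> y = x \<bullet> h" for y
  proof -
    have "bounded_linear (\<lambda>x. A x \<bullet> y)"
      by (intro bounded_linear_compose[OF bounded_linear_inner_left blinfun.bounded_linear_right])
    from variational_equation_solvable[OF bounded_linear_zero this zero_less_one, where 'b = real]
    show ?thesis by (auto simp: inner_commute) metis
  qed
  then have "\<exists>g. \<forall>x y. A x \<bullet> y = x \<bullet> g y" by metis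
  from someI_ex[OF this] show ?thesis
    unfolding adjoint_def by blast
qed

text \<open>The weak form of \<open>\<alpha> h = A* p\<close> with \<open>p = r - A h\<close>,
  through which all later arguments handle the step. The variational solution shows that
  \<open>adjoint A r\<close> lies in the range of \<open>B\<close>, so \<open>inv\<close> returns an
  actual preimage.\<close>

lemma inner_lm_step:
  assumes \<alpha>: "\<alpha> > 0"
  shows "\<alpha> * (lm_step \<alpha> A r \<bullet> v) = (r - A (lm_step \<alpha> A r)) \<bullet> A v"
proof -
  define B where "B h = adjoint A (A h) + \<alpha> *\<^sub>R h" for h
  have B: "B h \<bullet> v = \<alpha> * (h \<bullet> v) + A h \<bullet> A v" for h v
    using inner_adjoint_blinfun[of A v "A h"] by (simp add: B_def inner_add_left inner_add_right inner_commute)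
  have "bounded_linear (\<lambda>v. r \<bullet> A v)"
    by (intro bounded_linear_compose[OF bounded_linear_inner_right blinfun.bounded_linear_right])
  from variational_equation_solvable[OF blinfun.bounded_linear_right this \<alpha>]
  obtain h where h: "\<And>v. \<alpha> * (h \<bullet> v) + A h \<bullet> A v = r \<bullet> A v"
    by metis
  have "v \<bullet> B h = v \<bullet> adjoint A r" for v
    using B[of h v] h[of v] inner_adjoint_blinfun[of A v r] by (simp add: inner_commute)
  then have "B h = adjoint A r"
    using vector_eq_ldot by blast
  then have "adjoint A r \<in> range B" by (metis rangeI)
  moreover have "lm_step \<alpha> A r = inv B (adjoint A r)"
    by (simp add: lm_step_def B_def[abs_def])
  ultimately have "B (lm_step \<alpha> A r) = adjoint A r"
    by (simp add: f_inv_into_f)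
  then have "\<alpha> * (lm_step \<alpha> A r \<bullet> v) + A (lm_step \<alpha> A r) \<bullet> A v = r \<bullet> A v"
    using B[of "lm_step \<alpha> A r" v] inner_adjoint_blinfun[of A v r] by (simp add: inner_commute)
  then show ?thesis by (simp add: inner_diff_left)
qed

text \<open>Testing the weak form with \<open>h\<close> gives
  \<open>p \<bullet> A h \<ge> 0\<close>, so in \<open>r = p + A h\<close> the second summand cannot
  shorten the first.\<close>

lemma norm_lm_residual_le:
  assumes "\<alpha> > 0"
  shows "norm (r - blinfun_apply A (lm_step \<alpha> A r)) \<le> norm r"
proof -
  define h p where "h = lm_step \<alpha> A r" and "p = r - A h"
  have "p \<bullet> A h \<ge> 0"
    using inner_lm_step[OF assms, of A r h] assms unfolding h_def p_def
    by (metis inner_ge_zero less_eq_real_def mult_nonneg_nonneg)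
  have "(norm p)\<^sup>2 \<le> (norm p)\<^sup>2 + 2 * (p \<bullet> A h) + (norm (A h))\<^sup>2"
    using \<open>p \<bullet> A h \<ge> 0\<close> by simp
  also have "\<dots> = (norm (p + A h))\<^sup>2"
    by (simp add: power2_norm_eq_inner algebra_simps inner_commute)
  also have "p + A h = r"
    by (simp add: p_def)
  finally show ?thesis
    unfolding p_def h_def by (rule power2_le_imp_le) simp
qed

lemma norm_lm_step_le_residual:
  assumes \<alpha>: "\<alpha> > 0" and C: "norm A \<le> C"
  shows "\<alpha> * norm (lm_step \<alpha> A r) \<le> C * norm (r - A (lm_step \<alpha> A r))"
proof -
  define h p where "h = lm_step \<alpha> A r" and "p = r - A h"
  have "\<alpha> * (norm h)\<^sup>2 = p \<bullet> A h"
    using inner_lm_step[OF \<alpha>, of A r h] by (simp add: h_def p_def power2_norm_eq_inner)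
  also have "\<dots> \<le> norm p * (norm A * norm h)"
    by (metis norm_cauchy_schwarz norm_blinfun mult_left_mono norm_ge_zero order_trans)
  also have "\<dots> \<le> norm p * (C * norm h)"
    using C by (intro mult_left_mono mult_right_mono) auto
  finally have "(\<alpha> * norm h) * norm h \<le> (C * norm p) * norm h"
    by (simp add: power2_eq_square algebra_simps)
  moreover have "0 \<le> C * norm p"
    using order_trans[OF norm_ge_zero C] by simp
  ultimately have "\<alpha> * norm h \<le> C * norm p"
    by (cases "h = 0") auto
  then show ?thesis by (simp add: p_def h_def)
qed

lemma norm_lm_step_le:
  assumes \<alpha>: "\<alpha> > 0" and C: "norm A \<le> C"
  shows "norm (lm_step \<alpha> A r) \<le> C / \<alpha> * norm r"
proof -
  have "0 \<le> C" using C norm_ge_zero[of A] by linarith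
  then have "\<alpha> * norm (lm_step \<alpha> A r) \<le> C * norm r"
    using norm_lm_step_le_residual[OF assms, of r] norm_lm_residual_le[OF \<alpha>, of r A]
    by (meson mult_left_mono order_trans)
  then show ?thesis using \<alpha> by (simp add: field_simps)
qed

text \<open>Since \<open>\<alpha> h = A* p\<close>, the norm of \<open>A h\<close> is at most
  \<open>C\<^sup>2 / \<alpha>\<close> times that of \<open>p\<close>; the triangle inequality for
  \<open>r = p + A h\<close> then gives the constant.\<close>

lemma norm_lm_residual_ge:
  assumes \<alpha>: "\<alpha> > 0" and C: "norm A \<le> C"
  shows "\<alpha> / (\<alpha> + C\<^sup>2) * norm r \<le> norm (r - A (lm_step \<alpha> A r))"
proof -
  define h p where "h = lm_step \<alpha> A r" and "p = r - A h"
  have C0: "0 \<le> C" using C norm_ge_zero[of A] by linarith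
  have "norm (A h) \<le> C * norm h"
    using C by (meson mult_right_mono norm_blinfun norm_ge_zero order_trans)
  then have "\<alpha> * norm (A h) \<le> C * (\<alpha> * norm h)"
    using \<alpha> by (metis mult.left_commute mult_left_mono less_imp_le)
  also have "\<dots> \<le> C * (C * norm p)"
    using norm_lm_step_le_residual[OF assms, of r] C0 unfolding h_def p_def by (intro mult_left_mono)
  finally have 1: "\<alpha> * norm (A h) \<le> C\<^sup>2 * norm p"
    by (simp add: power2_eq_square)
  have "\<alpha> * norm r \<le> \<alpha> * (norm p + norm (A h))"
    using \<alpha> norm_triangle_ineq[of p "A h"] by (intro mult_left_mono) (auto simp: p_def)
  also have "\<dots> \<le> (\<alpha> + C\<^sup>2) * norm p"
    using 1 by (simp add: algebra_simps)
  finally have "\<alpha> * norm r \<le> (\<alpha> + C\<^sup>2) * norm p" .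
  moreover have "0 < \<alpha> + C\<^sup>2" using \<alpha> by (simp add: add_pos_nonneg)
  ultimately have "\<alpha> / (\<alpha> + C\<^sup>2) * norm r \<le> norm p"
    by (simp add: field_simps)
  then show ?thesis by (simp add: p_def h_def)
qed

lemma norm_lm_step_diff_le:
  fixes A A' :: "'a::{real_inner, complete_space} \<Rightarrow>\<^sub>L 'b::{real_inner, complete_space}" and r r' :: 'b
  assumes \<alpha>: "\<alpha> > 0"
  defines "h \<equiv> lm_step \<alpha> A r"
  shows "\<alpha> * norm (lm_step \<alpha> A' r' - h) \<le>
    (norm (r' - r) + norm (A' - A) * norm h) * norm A' + norm (r - A h) * norm (A' - A)"
proof -
  define d where "d = lm_step \<alpha> A' r' - h"
  have A'A: "A' v = A v + (A' - A) v" for v by (simp add: blinfun.diff_left)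
  have "\<alpha> * (norm d)\<^sup>2 = \<alpha> * (lm_step \<alpha> A' r' \<bullet> d) - \<alpha> * (h \<bullet> d)"
    by (simp add: power2_norm_eq_inner d_def algebra_simps)
  also have "\<dots> = (r' - A' (h + d)) \<bullet> A' d - (r - A h) \<bullet> A d"
    using inner_lm_step[OF \<alpha>, of A' r' d] inner_lm_step[OF \<alpha>, of A r d]
    by (simp add: d_def h_def)
  also have "\<dots> = ((r' - r) - (A' - A) h) \<bullet> A' d + (r - A h) \<bullet> (A' - A) d - A' d \<bullet> A' d"
    by (simp add: blinfun.diff_left blinfun.add_right algebra_simps)
  also have "\<dots> \<le> norm ((r' - r) - (A' - A) h) * norm (A' d) + norm (r - A h) * norm ((A' - A) d)"
    using norm_cauchy_schwarz[of "(r' - r) - (A' - A) h" "A' d"]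
      norm_cauchy_schwarz[of "r - A h" "(A' - A) d"] inner_ge_zero[of "A' d"] by linarith
  also have "\<dots> \<le> (norm (r' - r) + norm (A' - A) * norm h) * (norm A' * norm d)
      + norm (r - A h) * (norm (A' - A) * norm d)"
    by (intro add_mono mult_mono norm_blinfun order_refl mult_nonneg_nonneg add_nonneg_nonneg
        norm_ge_zero order_trans[OF norm_triangle_ineq4])
  finally have "(\<alpha> * norm d) * norm d \<le> ((norm (r' - r) + norm (A' - A) * norm h) * norm A'
      + norm (r - A h) * norm (A' - A)) * norm d" (is "_ \<le> ?R * _")
    by (simp add: power2_eq_square algebra_simps)
  moreover have "0 \<le> ?R" by simp
  ultimately have "\<alpha> * norm d \<le> ?R"
    by (cases "d = 0") auto
  then show ?thesis by (simp add: d_def)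
qed

lemma tendsto_lm_step:
  assumes \<alpha>: "\<alpha> > 0" and A: "(A \<longlongrightarrow> A0) \<F>" and r: "(r \<longlongrightarrow> r0) \<F>"
  shows "((\<lambda>j. lm_step \<alpha> (A j) (r j)) \<longlongrightarrow> lm_step \<alpha> A0 r0) \<F>"
proof -
  define h where "h = lm_step \<alpha> A0 r0"
  define g where "g j = ((norm (r j - r0) + norm (A j - A0) * norm h) * norm (A j)
      + norm (r0 - A0 h) * norm (A j - A0)) / \<alpha>" for j
  have "(g \<longlongrightarrow> ((norm (r0 - r0) + norm (A0 - A0) * norm h) * norm A0
      + norm (r0 - A0 h) * norm (A0 - A0)) / \<alpha>) \<F>"
    unfolding g_def using \<alpha> by (intro tendsto_intros A r) auto
  then have "(g \<longlongrightarrow> 0) \<F>" by simp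
  moreover have "norm (lm_step \<alpha> (A j) (r j) - h) \<le> g j" for j
    using norm_lm_step_diff_le[OF \<alpha>, of "A j" "r j" A0 r0] \<alpha>
    by (simp add: g_def h_def field_simps)
  ultimately have "((\<lambda>j. lm_step \<alpha> (A j) (r j) - h) \<longlongrightarrow> 0) \<F>"
    by (rule Lim_null_comparison[OF always_eventually[OF allI], rotated])
  then show ?thesis unfolding h_def by (rule Lim_null[THEN iffD2])
qed

text \<open>With \<open>p = r - A h\<close> one has \<open>r = p + A h\<close> and \<open>p \<bullet> A h = \<alpha> (norm h)\<^sup>2\<close>, so
  \<open>\<alpha> h \<bullet> (x - z) = p \<bullet> (- r + s)\<close> is negative as soon as the linearization error \<open>s\<close> is smaller than \<open>p\<close>.\<close>

lemma lm_step_descent: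
  fixes A :: "'a::{real_inner, complete_space} \<Rightarrow>\<^sub>L 'b::{real_inner, complete_space}"
    and x z :: 'a and r :: 'b and \<alpha> \<kappa> C :: real
  assumes \<alpha>: "\<alpha> > 0" and C: "norm A \<le> C"
    and s: "norm (r - blinfun_apply A (z - x)) \<le> \<kappa> * norm r"
    and \<kappa>: "0 \<le> \<kappa>" "\<kappa> \<le> \<alpha> / (\<alpha> + C\<^sup>2)"
  defines "h \<equiv> lm_step \<alpha> A r" and "\<beta> \<equiv> \<alpha> / (\<alpha> + C\<^sup>2)"
  shows "(norm (x + h - z))\<^sup>2 + 2 / \<alpha> * \<beta> * (\<beta> - \<kappa>) * (norm r)\<^sup>2 \<le> (norm (x - z))\<^sup>2"
proof -
  define p where "p = r - A h"
  define s where "s = r - A (z - x)"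
  have weak: "\<alpha> * (h \<bullet> v) = p \<bullet> A v" for v
    using inner_lm_step[OF \<alpha>, of A r v] by (simp add: h_def p_def)
  have p_ge: "\<beta> * norm r \<le> norm p"
    using norm_lm_residual_ge[OF \<alpha> C, of r] by (simp add: h_def p_def \<beta>_def)
  have "\<beta> \<ge> 0" using \<alpha> by (simp add: \<beta>_def)
  have "p \<bullet> s \<le> norm p * (\<kappa> * norm r)"
    using assms(3) by (metis norm_cauchy_schwarz mult_left_mono norm_ge_zero order_trans s_def)
  moreover have "(\<beta> * norm r) * ((\<beta> - \<kappa>) * norm r) \<le> norm p * (norm p - \<kappa> * norm r)"
  proof (intro mult_mono p_ge norm_ge_zero)
    show "(\<beta> - \<kappa>) * norm r \<le> norm p - \<kappa> * norm r"
      using p_ge by (simp add: left_diff_distrib)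
    show "0 \<le> (\<beta> - \<kappa>) * norm r"
      using \<kappa> by (simp add: \<beta>_def)
  qed
  ultimately have 1: "\<beta> * (\<beta> - \<kappa>) * (norm r)\<^sup>2 \<le> p \<bullet> p - p \<bullet> s"
    by (simp add: algebra_simps power2_eq_square power2_norm_eq_inner[symmetric])
  have "r = p + A h" by (simp add: p_def)
  have "\<alpha> * (h \<bullet> (x - z)) = p \<bullet> (s - r)"
    unfolding weak by (simp add: s_def blinfun.diff_right)
  also have "\<dots> = p \<bullet> s - p \<bullet> p - \<alpha> * (h \<bullet> h)"
    unfolding weak by (subst \<open>r = p + A h\<close>) (simp add: algebra_simps)
  finally have 2: "\<alpha> * (h \<bullet> (x - z)) + \<alpha> * (h \<bullet> h) \<le> - (\<beta> * (\<beta> - \<kappa>) * (norm r)\<^sup>2)"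
    using 1 by linarith
  have "\<alpha> * ((norm (x + h - z))\<^sup>2 - (norm (x - z))\<^sup>2) = 2 * (\<alpha> * (h \<bullet> (x - z))) + \<alpha> * (h \<bullet> h)"
    by (simp add: power2_norm_eq_inner algebra_simps inner_commute)
  also have "\<dots> \<le> - (2 * (\<beta> * (\<beta> - \<kappa>) * (norm r)\<^sup>2))"
    using 2 mult_nonneg_nonneg[OF less_imp_le[OF \<alpha>] inner_ge_zero[of h]] by linarith
  finally show ?thesis
    using \<alpha> by (simp add: field_simps)
qed

text \<open>Both \<open>z k\<close> and \<open>z l\<close> are compared with \<open>z n\<close>, where \<open>n\<close> minimizes \<open>R\<close> on \<open>{k..l}\<close>.\<close>

lemma Cauchy_if_increments_bounded_by_minimum:
  fixes z :: "nat \<Rightarrow> 'a::real_inner" and R :: "nat \<Rightarrow> real"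
  assumes dec: "decseq (\<lambda>k. norm (z k - p))"
    and sm: "summable (\<lambda>k. (R k)\<^sup>2)"
    and inc: "\<And>i n. R n \<le> R i \<Longrightarrow> \<bar>(z (Suc i) - z i) \<bullet> (z n - p)\<bar> \<le> K * (R i)\<^sup>2"
    and K: "K \<ge> 0"
  shows "Cauchy z"
proof (rule metric_CauchyI)
  fix e :: real
  assume "0 < e"
  define E where "E k = (norm (z k - p))\<^sup>2" for k
  \<comment> \<open>Chosen so that \<open>(1 + 2 * K) * d\<close> equals
    \<open>e\<^sup>2 / 8\<close>, which is below \<open>(e / 2)\<^sup>2\<close>.\<close>
  define d where "d = e\<^sup>2 / 8 / (1 + 2 * K)"
  have "d > 0" using \<open>0 < e\<close> K by (simp add: d_def)
  have decE: "decseq E"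
    using dec by (auto simp: decseq_def E_def intro!: power_mono)
  obtain L where "E \<longlonglongrightarrow> L"
    using decseq_convergent[OF decE, of 0] by (auto simp: E_def)
  then have "Cauchy E" by (intro LIMSEQ_imp_Cauchy)
  then obtain M1 where M1: "\<And>a b. a \<ge> M1 \<Longrightarrow> b \<ge> M1 \<Longrightarrow> \<bar>E a - E b\<bar> < d"
    using metric_CauchyD[of E d] \<open>d > 0\<close> by (auto simp: dist_real_def)
  obtain M2 where M2: "\<And>a b. a \<ge> M2 \<Longrightarrow> norm (\<Sum>i=a..<b. (R i)\<^sup>2) < d"
    using sm \<open>d > 0\<close> unfolding summable_Cauchy by blast
  have tele: "\<bar>(z b - z a) \<bullet> (z n - p)\<bar> \<le> K * d"
    if "M2 \<le> a" "a \<le> b" and n: "\<And>i. i \<in> {a..<b} \<Longrightarrow> R n \<le> R i" for a b n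
  proof -
    have "(z b - z a) \<bullet> (z n - p) = (\<Sum>i=a..<b. (z (Suc i) - z i) \<bullet> (z n - p))"
      using sum_Suc_diff'[OF \<open>a \<le> b\<close>, of z] by (simp add: inner_sum_left[symmetric])
    also have "\<bar>\<dots>\<bar> \<le> (\<Sum>i=a..<b. K * (R i)\<^sup>2)"
      using n inc by (intro order_trans[OF sum_abs] sum_mono) auto
    also have "\<dots> \<le> K * d"
      using M2[of a b] that K
      by (auto simp: sum_distrib_left[symmetric] intro!: mult_left_mono)
    finally show ?thesis .
  qed
  have "dist (z k) (z l) < e" if kl: "max M1 M2 \<le> k" "k \<le> l" for k l
  proof -
    obtain n where n: "n \<in> {k..l}" "\<And>i. i \<in> {k..l} \<Longrightarrow> R n \<le> R i"
      using ex_is_arg_min_if_finite[of "{k..l}" R] kl by (auto simp: is_arg_min_linorder)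
    have close: "norm (z n - z a) < e / 2" if a: "a = k \<or> a = l" for a
    proof -
      have "\<bar>(z n - z a) \<bullet> (z n - p)\<bar> \<le> K * d"
        using a
      proof
        assume "a = k"
        then show ?thesis using tele[of k n n] n kl by auto
      next
        assume "a = l"
        then show ?thesis
          using tele[of n l n] n kl by (auto simp: inner_diff_left)
      qed
      moreover have "(norm (z n - z a))\<^sup>2 = 2 * ((z n - z a) \<bullet> (z n - p)) + (E a - E n)"
        by (simp add: E_def power2_norm_eq_inner algebra_simps inner_commute)
      moreover have "E a - E n < d" using M1[of a n] n(1) a kl by auto
      ultimately have "(norm (z n - z a))\<^sup>2 < (1 + 2 * K) * d"
        by (simp add: algebra_simps)
      also have "\<dots> = e\<^sup>2 / 8"
      proof -
        have "1 + 2 * K \<noteq> 0" using K by linarith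
        then show ?thesis
          unfolding d_def times_divide_eq_right[of "1 + 2 * K" "e\<^sup>2 / 8" "1 + 2 * K"]
          by (rule nonzero_mult_div_cancel_left)
      qed
      also have "\<dots> \<le> (e / 2)\<^sup>2" by (simp add: power2_eq_square)
      finally show ?thesis
        by (rule power_less_imp_less_base) (use \<open>0 < e\<close> in simp)
    qed
    show ?thesis
      using close[of k] close[of l] dist_triangle_half_r[of "z n" "z k" e "z l"]
      by (simp add: dist_norm)
  qed
  then show "\<exists>M. \<forall>k\<ge>M. \<forall>l\<ge>M. dist (z k) (z l) < e"
    by (metis dist_commute nle_le)
qed


section \<open>The loping Levenberg-Marquardt-Kaczmarz iteration\<close>

locale lmk_setting =
  fixes N :: nat
    and D :: "nat \<Rightarrow> 'a::{real_inner, complete_space} set"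
    and F :: "nat \<Rightarrow> 'a \<Rightarrow> 'b::{real_inner, complete_space}"
    and F' :: "nat \<Rightarrow> 'a \<Rightarrow> 'a \<Rightarrow>\<^sub>L 'b"
    and y :: "nat \<Rightarrow> 'b"
    and x0 xstar :: 'a
    and \<rho> C \<eta> \<alpha> \<tau> q :: real
  assumes N: "N \<ge> 1"
    and rho: "\<rho> > 0"
    and ball_D: "\<And>i. i < N \<Longrightarrow> ball x0 \<rho> \<subseteq> D i"
    and cont_F: "\<And>i. i < N \<Longrightarrow> continuous_on (D i) (F i)"
    and cont_F': "\<And>i. i < N \<Longrightarrow> continuous_on (D i) (F' i)"
    and C: "C > 0"
    and F'_le: "\<And>i x. i < N \<Longrightarrow> x \<in> ball x0 \<rho> \<Longrightarrow> norm (F' i x) \<le> C"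
    and eta_less_1: "\<eta> < 1"
    and tcc: "\<And>i x xb. i < N \<Longrightarrow> x \<in> ball x0 \<rho> \<Longrightarrow> xb \<in> ball x0 \<rho> \<Longrightarrow>
           norm (F i xb - F i x - blinfun_apply (F' i x) (xb - x)) \<le> \<eta> * norm (F i xb - F i x)"
    and xstar_ball: "xstar \<in> ball x0 (\<rho>/2)"
    and xstar_sol: "is_solution N D F y xstar"
    and q: "0 < q" "q < 1"
    and alpha: "\<alpha> > C\<^sup>2 * q / (1 - q)"
    and tau: "\<tau> > (1 + \<eta>) / (1 - \<eta>)"
    and eta_frac: "(1 + \<eta>) / (1 - \<eta>) > 1"
    and kappa_less_q: "\<eta> + (1 + \<eta>) * inverse \<tau> < q"
begin

text \<open>At an active step, \<open>\<beta>\<close> bounds the linearized residual from below and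
  \<open>\<kappa>\<close> bounds the linearization error at a solution from above, both relative to
  the residual. \<open>\<gamma>\<close> is the gain that \<open>lm_step_descent\<close> then
  provides.\<close>

definition "\<beta> = \<alpha> / (\<alpha> + C\<^sup>2)"
definition "\<kappa> = \<eta> + (1 + \<eta>) * inverse \<tau>"
definition "\<gamma> = 2 / \<alpha> * \<beta> * (\<beta> - \<kappa>)"

lemma alpha_pos: "0 < \<alpha>"
proof -
  have "0 \<le> C\<^sup>2 * q / (1 - q)" using q by simp
  then show ?thesis using alpha by linarith
qed

lemma eta_pos: "0 < \<eta>"
  using eta_frac eta_less_1 by (simp add: field_simps)

lemma tau_pos: "0 < \<tau>"
  using tau eta_frac by linarith

lemma kappa_nonneg: "0 \<le> \<kappa>"
  using eta_pos tau_pos by (simp add: \<kappa>_def)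

text \<open>The lower bound on \<open>\<alpha>\<close> is a rearrangement of
  \<open>q < \<beta>\<close>, so \<open>q\<close> separates \<open>\<kappa>\<close> from
  \<open>\<beta>\<close>.\<close>

lemma kappa_less_beta: "\<kappa> < \<beta>"
proof -
  have "C\<^sup>2 * q < \<alpha> * (1 - q)"
    using alpha q by (simp add: field_simps)
  then have "q * (\<alpha> + C\<^sup>2) < \<alpha>"
    by (simp add: algebra_simps)
  then have "q < \<beta>"
    using alpha_pos by (simp add: \<beta>_def pos_less_divide_eq add_pos_nonneg)
  then show ?thesis
    using kappa_less_q by (simp add: \<kappa>_def)
qed

lemma gamma_pos: "0 < \<gamma>"
  unfolding \<gamma>_def using kappa_nonneg kappa_less_beta alpha_pos by (intro mult_pos_pos) auto

section \<open>Consequences of the tangential cone condition and continuity\<close>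

lemma norm_linearization_le:
  assumes "i < N" "u \<in> ball x0 \<rho>" "v \<in> ball x0 \<rho>"
  shows "norm (F' i u (v - u)) \<le> (1 + \<eta>) * norm (F i v - F i u)"
  using tcc[OF assms(1-3)] norm_triangle_ineq4[of "F i v - F i u" "F i v - F i u - F' i u (v - u)"]
  by (simp add: algebra_simps)

text \<open>As \<open>\<eta> < 1\<close>, the cone condition lets the nonlinear remainder be
  absorbed on the left, so the bound on the linearization becomes a Lipschitz bound.\<close>

lemma norm_F_diff_le:
  assumes "i < N" "u \<in> ball x0 \<rho>" "v \<in> ball x0 \<rho>"
  shows "norm (F i v - F i u) \<le> C / (1 - \<eta>) * norm (v - u)"
proof -
  have "norm (F' i u (v - u)) \<le> C * norm (v - u)"
    using F'_le[OF assms(1,2)] by (meson mult_right_mono norm_blinfun norm_ge_zero order_trans)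
  moreover have "norm (F i v - F i u) \<le> norm (F i v - F i u - F' i u (v - u)) + norm (F' i u (v - u))"
    using norm_triangle_ineq[of "F i v - F i u - F' i u (v - u)" "F' i u (v - u)"] by simp
  ultimately have "(1 - \<eta>) * norm (F i v - F i u) \<le> C * norm (v - u)"
    using tcc[OF assms] by (simp add: algebra_simps)
  then show ?thesis
    using eta_less_1 by (simp add: field_simps)
qed

lemma tendsto_F:
  assumes "i < N" "(u \<longlongrightarrow> l) \<F>" "l \<in> ball x0 \<rho>"
  shows "((\<lambda>j. F i (u j)) \<longlongrightarrow> F i l) \<F>" "((\<lambda>j. F' i (u j)) \<longlongrightarrow> F' i l) \<F>"
proof -
  have "continuous_on (ball x0 \<rho>) (F i)" "continuous_on (ball x0 \<rho>) (F' i)"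
    using assms(1) by (auto intro: continuous_on_subset[OF cont_F ball_D] continuous_on_subset[OF cont_F' ball_D])
  then have "isCont (F i) l" "isCont (F' i) l"
    using assms(3) by (simp_all add: continuous_on_eq_continuous_at)
  then show "((\<lambda>j. F i (u j)) \<longlongrightarrow> F i l) \<F>" "((\<lambda>j. F' i (u j)) \<longlongrightarrow> F' i l) \<F>"
    by (auto intro: isCont_tendsto_compose[OF _ assms(2)])
qed

lemma ball_in_D: "i < N \<Longrightarrow> u \<in> ball x0 \<rho> \<Longrightarrow> u \<in> D i"
  using ball_D by blast

lemma xstar_in_ball: "xstar \<in> ball x0 \<rho>"
  using xstar_ball rho by auto

section \<open>Monotonicity and finite stopping for noisy data\<close>

definition admissible :: "(nat \<Rightarrow> real) \<Rightarrow> (nat \<Rightarrow> 'b) \<Rightarrow> bool"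
  where "admissible \<delta> yd \<longleftrightarrow> (\<forall>i<N. 0 \<le> \<delta> i \<and> norm (yd i - y i) \<le> \<delta> i)"

abbreviation iter :: "(nat \<Rightarrow> real) \<Rightarrow> (nat \<Rightarrow> 'b) \<Rightarrow> nat \<Rightarrow> 'a"
  where "iter \<equiv> lmk_iterate N F F' \<alpha> \<tau> x0"

definition resid :: "(nat \<Rightarrow> real) \<Rightarrow> (nat \<Rightarrow> 'b) \<Rightarrow> nat \<Rightarrow> 'b"
  where "resid \<delta> yd k = yd (k mod N) - F (k mod N) (iter \<delta> yd k)"

definition update :: "(nat \<Rightarrow> real) \<Rightarrow> (nat \<Rightarrow> 'b) \<Rightarrow> nat \<Rightarrow> 'a"
  where "update \<delta> yd k = lm_step \<alpha> (F' (k mod N) (iter \<delta> yd k)) (resid \<delta> yd k)"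

definition active :: "(nat \<Rightarrow> real) \<Rightarrow> (nat \<Rightarrow> 'b) \<Rightarrow> nat \<Rightarrow> bool"
  where "active \<delta> yd k \<longleftrightarrow> \<tau> * \<delta> (k mod N) \<le> norm (resid \<delta> yd k)"

lemma mod_less: "k mod N < N"
  using N by simp

lemma iter_Suc: "iter \<delta> yd (Suc k) = iter \<delta> yd k + (if active \<delta> yd k then update \<delta> yd k else 0)"
  by (simp add: active_def update_def resid_def Let_def norm_minus_commute)

declare lmk_iterate.simps(2) [simp del]

lemma norm_update_le:
  assumes "iter \<delta> yd k \<in> ball x0 \<rho>"
  shows "norm (update \<delta> yd k) \<le> C / \<alpha> * norm (resid \<delta> yd k)"
  unfolding update_def using assms F'_le mod_less alpha_pos by (intro norm_lm_step_le) auto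

text \<open>An active step has \<open>\<delta> i\<close> at most \<open>norm r / \<tau>\<close>, so
  the noise can be absorbed into the residual and the linearization error at \<open>z\<close> is at
  most \<open>\<kappa> * norm r\<close>. Membership of the iterate in the ball is assumed here and
  established afterwards by induction.\<close>

lemma iter_descent_if_in_ball:
  assumes adm: "admissible \<delta> yd" and x: "iter \<delta> yd k \<in> ball x0 \<rho>"
    and z: "z \<in> ball x0 \<rho>" "is_solution N D F y z"
  shows "(norm (iter \<delta> yd (Suc k) - z))\<^sup>2 + (if active \<delta> yd k then \<gamma> * (norm (resid \<delta> yd k))\<^sup>2 else 0)
    \<le> (norm (iter \<delta> yd k - z))\<^sup>2"
proof (cases "active \<delta> yd k")
  case True
  define i where "i = k mod N"
  define r where "r = resid \<delta> yd k"
  define x where "x = iter \<delta> yd k"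
  have i: "i < N" using mod_less by (simp add: i_def)
  have Fz: "F i z = y i" using z(2) i by (simp add: is_solution_def)
  have \<delta>: "0 \<le> \<delta> i" "norm (yd i - y i) \<le> \<delta> i" using adm i by (auto simp: admissible_def)
  have r: "r = yd i - F i x" by (simp add: r_def resid_def i_def x_def)
  have act: "\<delta> i \<le> inverse \<tau> * norm r"
    using True tau_pos by (simp add: active_def r_def i_def field_simps)
  have lin: "norm (F i z - F i x - F' i x (z - x)) \<le> \<eta> * norm (F i z - F i x)"
    using tcc[OF i _ z(1)] assms(2) by (simp add: x_def)
  have "norm (y i - F i x) \<le> norm r + \<delta> i"
    using \<delta>(2) norm_triangle_ineq4[of r "yd i - y i"] by (simp add: r)
  then have "\<eta> * norm (y i - F i x) \<le> \<eta> * (norm r + \<delta> i)"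
    using eta_pos by (intro mult_left_mono) auto
  moreover have "r - F' i x (z - x) = (yd i - y i) + (F i z - F i x - F' i x (z - x))"
    by (simp add: r Fz)
  then have "norm (r - F' i x (z - x)) \<le> norm (yd i - y i) + norm (F i z - F i x - F' i x (z - x))"
    using norm_triangle_ineq by metis
  ultimately have "norm (r - F' i x (z - x)) \<le> \<delta> i + \<eta> * (norm r + \<delta> i)"
    using \<delta>(2) lin Fz by simp
  also have "\<dots> = \<eta> * norm r + (1 + \<eta>) * \<delta> i"
    by (simp add: algebra_simps)
  also have "\<dots> \<le> \<eta> * norm r + (1 + \<eta>) * (inverse \<tau> * norm r)"
    using act eta_pos by (intro add_left_mono mult_left_mono) auto
  also have "\<dots> = \<kappa> * norm r"
    by (simp add: \<kappa>_def algebra_simps)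
  finally have s: "norm (r - F' i x (z - x)) \<le> \<kappa> * norm r" .
  have "norm (F' i x) \<le> C"
    using F'_le[OF i assms(2)] by (simp add: x_def)
  from lm_step_descent[OF alpha_pos this s kappa_nonneg] kappa_less_beta
  show ?thesis
    using True by (simp add: \<beta>_def \<gamma>_def iter_Suc update_def i_def x_def r_def)
qed (simp add: iter_Suc)

text \<open>The distance to \<open>xstar\<close> never exceeds its initial value, which is below
  \<open>\<rho>/2\<close>; since \<open>xstar\<close> is itself that close to \<open>x0\<close>, the
  iterates cannot leave the ball.\<close>

lemma iter_in_ball:
  assumes adm: "admissible \<delta> yd"
  shows "iter \<delta> yd k \<in> ball x0 \<rho>"
proof -
  have near: "x \<in> ball x0 \<rho>" if "norm (x - xstar) \<le> norm (x0 - xstar)" for x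
    using dist_triangle[of x0 x xstar] that xstar_ball by (simp add: dist_norm norm_minus_commute)
  have "norm (iter \<delta> yd k - xstar) \<le> norm (x0 - xstar)"
  proof (induction k)
    case (Suc k)
    have "(norm (iter \<delta> yd (Suc k) - xstar))\<^sup>2 \<le> (norm (iter \<delta> yd k - xstar))\<^sup>2"
      using iter_descent_if_in_ball[OF adm near[OF Suc] xstar_in_ball xstar_sol] gamma_pos
      by (smt (verit) mult_nonneg_nonneg zero_le_power2)
    then show ?case
      using Suc power2_le_imp_le norm_ge_zero order_trans by blast
  qed simp
  then show ?thesis by (rule near)
qed

lemmas iter_descent = iter_descent_if_in_ball[OF _ iter_in_ball]

lemma decseq_norm_iter_diff:
  assumes "admissible \<delta> yd" "z \<in> ball x0 \<rho>" "is_solution N D F y z"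
  shows "decseq (\<lambda>k. norm (iter \<delta> yd k - z))"
proof (rule decseq_SucI)
  fix k
  have "(norm (iter \<delta> yd (Suc k) - z))\<^sup>2 \<le> (norm (iter \<delta> yd k - z))\<^sup>2"
    using iter_descent[OF assms(1,1,2,3), of k] gamma_pos
    by (smt (verit) mult_nonneg_nonneg zero_le_power2)
  then show "norm (iter \<delta> yd (Suc k) - z) \<le> norm (iter \<delta> yd k - z)"
    by (rule power2_le_imp_le) simp
qed

text \<open>The gains at active steps telescope against the initial squared distance to
  \<open>xstar\<close>.\<close>

lemma summable_active_resid:
  assumes "admissible \<delta> yd"
  shows "summable (\<lambda>k. if active \<delta> yd k then (norm (resid \<delta> yd k))\<^sup>2 else 0)" (is "summable ?f")
proof (rule summableI_nonneg_bounded)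
  fix n
  have "\<gamma> * (\<Sum>k<n. ?f k) + (norm (iter \<delta> yd n - xstar))\<^sup>2 \<le> (norm (x0 - xstar))\<^sup>2"
  proof (induction n)
    case (Suc n)
    have "\<gamma> * ?f n + (norm (iter \<delta> yd (Suc n) - xstar))\<^sup>2 \<le> (norm (iter \<delta> yd n - xstar))\<^sup>2"
      using iter_descent[OF assms assms xstar_in_ball xstar_sol, of n] by (auto split: if_splits)
    then show ?case using Suc by (simp add: distrib_left)
  qed simp
  then have "\<gamma> * (\<Sum>k<n. ?f k) \<le> (norm (x0 - xstar))\<^sup>2"
    by (smt (verit) zero_le_power2)
  then show "(\<Sum>k<n. ?f k) \<le> (norm (x0 - xstar))\<^sup>2 / \<gamma>"
    using gamma_pos by (simp add: field_simps)
qed auto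

text \<open>An active residual is bounded below by the smallest \<open>\<tau> * \<delta> i\<close>,
  so summability of the squares permits only finitely many active steps. Existence of a stopping
  index makes \<open>LEAST\<close> meaningful.\<close>

lemma stopping_index_works:
  assumes adm: "admissible \<delta> yd" and pos: "\<And>i. i < N \<Longrightarrow> 0 < \<delta> i"
  obtains l where "stopping_index N (iter \<delta> yd) = l * N"
    and "\<And>i. i < N \<Longrightarrow> norm (yd i - F i (iter \<delta> yd (l * N))) < \<tau> * \<delta> i"
proof -
  let ?x = "iter \<delta> yd"
  define d where "d = Min ((\<lambda>i. (\<tau> * \<delta> i)\<^sup>2) ` {..<N})"
  have "N \<noteq> 0" using N by simp
  have "0 < d"
    unfolding d_def using tau_pos pos \<open>N \<noteq> 0\<close> by (subst Min_gr_iff) (force simp: lessThan_empty_iff)+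
  then have "\<forall>\<^sub>F k in sequentially. (if active \<delta> yd k then (norm (resid \<delta> yd k))\<^sup>2 else 0) < d"
    by (rule order_tendstoD(2)[OF summable_LIMSEQ_zero[OF summable_active_resid[OF adm]]])
  then obtain M where M: "\<And>k. k \<ge> M \<Longrightarrow> (if active \<delta> yd k then (norm (resid \<delta> yd k))\<^sup>2 else 0) < d"
    by (auto simp: eventually_sequentially)
  have inactive: "\<not> active \<delta> yd k" if "k \<ge> M" for k
  proof
    assume act: "active \<delta> yd k"
    have "d \<le> (\<tau> * \<delta> (k mod N))\<^sup>2"
      unfolding d_def using mod_less by (intro Min_le) auto
    also have "\<dots> \<le> (norm (resid \<delta> yd k))\<^sup>2"
      using act tau_pos pos[OF mod_less, of k] by (intro power_mono) (auto simp: active_def)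
    finally show False
      using M[OF that] act by simp
  qed
  have "?x (M * N + m) = ?x (M * N)" for m
    by (induction m) (use inactive N in \<open>auto simp: iter_Suc trans_le_add1\<close>)
  then have ex: "\<exists>k l. k = l * N \<and> (\<forall>m\<le>N. ?x (l * N + m) = ?x (l * N))"
    by blast
  from LeastI_ex[OF ex] obtain l where l: "stopping_index N ?x = l * N"
    "\<And>m. m \<le> N \<Longrightarrow> ?x (l * N + m) = ?x (l * N)"
    unfolding stopping_index_def by blast
  \<comment> \<open>Equal iterates alone do not exclude an active step with zero update; the strict
    descent at a nonzero residual does.\<close>
  have "norm (yd i - F i (?x (l * N))) < \<tau> * \<delta> i" if "i < N" for i
  proof (rule ccontr)
    let ?k = "l * N + i"
    assume "\<not> ?thesis"
    then have act: "active \<delta> yd ?k" and "resid \<delta> yd ?k \<noteq> 0"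
      using l(2)[of i] that mult_pos_pos[OF tau_pos pos[OF that]]
      by (auto simp: active_def resid_def)
    moreover have "?x (Suc ?k) = ?x ?k"
      using l(2)[of i] l(2)[of "Suc i"] that by simp
    ultimately have "\<gamma> * (norm (resid \<delta> yd ?k))\<^sup>2 \<le> 0"
      using iter_descent[OF adm adm xstar_in_ball xstar_sol, of ?k] by simp
    then show False
      using gamma_pos \<open>resid \<delta> yd ?k \<noteq> 0\<close> by (simp add: mult_le_0_iff)
  qed
  then show ?thesis using that l(1) by blast
qed

subsection \<open>Exact data\<close>

abbreviation exact :: "nat \<Rightarrow> 'a"
  where "exact \<equiv> iter (\<lambda>_. 0) y"

abbreviation exact_resid :: "nat \<Rightarrow> 'b"
  where "exact_resid \<equiv> resid (\<lambda>_. 0) y"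

lemma admissible_exact: "admissible (\<lambda>_. 0) y"
  by (simp add: admissible_def)

text \<open>With zero noise levels the threshold is zero, so no step is skipped.\<close>

lemma exact_Suc: "exact (Suc k) = exact k + update (\<lambda>_. 0) y k"
  by (simp add: iter_Suc active_def)

lemmas exact_in_ball = iter_in_ball[OF admissible_exact]

text \<open>Each residual is taken at the iterate where its equation is processed, not at the start
  of the cycle. This quantity plays the role of \<open>R\<close> in the Cauchy criterion.\<close>

definition cycle_resid :: "nat \<Rightarrow> real"
  where "cycle_resid m = (\<Sum>s<N. norm (exact_resid (m * N + s)))"

lemma cycle_resid_nonneg: "0 \<le> cycle_resid m"
  unfolding cycle_resid_def by (rule sum_nonneg) simp

text \<open>Cauchy-Schwarz within each cycle costs a factor \<open>N\<close>; regrouping the cycles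
  gives back the sum of all squared residuals.\<close>

lemma summable_cycle_resid: "summable (\<lambda>m. (cycle_resid m)\<^sup>2)"
proof (rule summableI_nonneg_bounded)
  fix n
  let ?f = "\<lambda>k. (norm (exact_resid k))\<^sup>2"
  have sm: "summable ?f"
    using summable_active_resid[OF admissible_exact] by (simp add: active_def)
  have "(cycle_resid m)\<^sup>2 \<le> N * (\<Sum>k\<in>{m * N..<m * N + N}. ?f k)" for m
  proof -
    have "(cycle_resid m)\<^sup>2 \<le> N * (\<Sum>s<N. ?f (m * N + s))"
      unfolding cycle_resid_def
      using sum_squared_le_sum_of_squares[of "\<lambda>s. norm (exact_resid (m * N + s))" "{..<N}"]
      by (simp add: mult.commute)
    then show ?thesis
      by (simp add: sum.shift_bounds_nat_ivl[of _ 0 "m * N" N, simplified] add.commute atLeast0LessThan)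
  qed
  then have "(\<Sum>m<n. (cycle_resid m)\<^sup>2) \<le> (\<Sum>m<n. N * (\<Sum>k\<in>{m * N..<m * N + N}. ?f k))"
    by (intro sum_mono)
  also have "\<dots> = N * (\<Sum>k<n * N. ?f k)"
    by (simp add: sum_distrib_left[symmetric] sum.nat_group)
  also have "\<dots> \<le> N * suminf ?f"
    by (intro mult_left_mono sum_le_suminf sm) auto
  finally show "(\<Sum>m<n. (cycle_resid m)\<^sup>2) \<le> N * suminf ?f" .
qed simp

lemma norm_exact_drift_le:
  assumes "s \<le> N"
  shows "norm (exact (m * N + s) - exact (m * N)) \<le> C / \<alpha> * cycle_resid m"
proof -
  have "norm (exact (m * N + s) - exact (m * N)) \<le> (\<Sum>t<s. C / \<alpha> * norm (exact_resid (m * N + t)))"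
  proof (induction s)
    case (Suc s)
    then show ?case
      using norm_update_le[OF exact_in_ball, of "m * N + s"]
        norm_triangle_ineq[of "exact (m * N + s) - exact (m * N)" "update (\<lambda>_. 0) y (m * N + s)"]
      by (simp add: exact_Suc algebra_simps)
  qed simp
  also have "\<dots> \<le> (\<Sum>t<N. C / \<alpha> * norm (exact_resid (m * N + t)))"
    using assms C alpha_pos by (intro sum_mono2) auto
  finally show ?thesis
    by (simp add: cycle_resid_def sum_distrib_left)
qed

text \<open>The summand 1 accounts for the residual at its own step; the product is the Lipschitz
  constant of \<open>F i\<close> times the drift constant within a cycle.\<close>

definition "\<mu> = 1 + C / (1 - \<eta>) * (C / \<alpha>)"

lemma norm_resid_cycle_start_le:
  assumes "i < N"
  shows "norm (y i - F i (exact (m * N))) \<le> \<mu> * cycle_resid m"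
proof -
  let ?k = "m * N + i"
  have "norm (F i (exact ?k) - F i (exact (m * N))) \<le> C / (1 - \<eta>) * norm (exact ?k - exact (m * N))"
    using assms by (intro norm_F_diff_le exact_in_ball)
  also have "\<dots> \<le> C / (1 - \<eta>) * (C / \<alpha> * cycle_resid m)"
    using assms C eta_less_1 by (intro mult_left_mono norm_exact_drift_le) auto
  finally have "norm (F i (exact ?k) - F i (exact (m * N))) \<le> C / (1 - \<eta>) * (C / \<alpha>) * cycle_resid m"
    by simp
  moreover have "norm (y i - F i (exact ?k)) \<le> cycle_resid m"
    using member_le_sum[of i "{..<N}" "\<lambda>s. norm (exact_resid (m * N + s))"] assms
    by (simp add: cycle_resid_def resid_def)
  moreover have "norm (y i - F i (exact (m * N))) \<le>
      norm (y i - F i (exact ?k)) + norm (F i (exact ?k) - F i (exact (m * N)))"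
    using norm_triangle_ineq[of "y i - F i (exact ?k)" "F i (exact ?k) - F i (exact (m * N))"] by simp
  ultimately show ?thesis
    by (simp add: \<mu>_def distrib_right)
qed

text \<open>Supplies the increment hypothesis of the Cauchy criterion. By the weak form each update
  tested with \<open>e\<close> is controlled by \<open>A e\<close>; splitting \<open>e\<close> at
  the current iterate, the cone condition reduces both pieces to residuals, and minimality of cycle
  \<open>n\<close> replaces its residual by that of cycle \<open>m\<close>.\<close>

lemma inner_cycle_increment_le:
  assumes "cycle_resid n \<le> cycle_resid m"
  shows "\<bar>(exact (Suc m * N) - exact (m * N)) \<bullet> (exact (n * N) - xstar)\<bar>
    \<le> (1 + \<eta>) * (\<mu> + 2) / \<alpha> * (cycle_resid m)\<^sup>2"
proof -
  define e where "e = exact (n * N) - xstar"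
  have \<mu>: "0 \<le> \<mu>" using C eta_less_1 alpha_pos by (simp add: \<mu>_def)
  have step: "\<bar>update (\<lambda>_. 0) y (m * N + s) \<bullet> e\<bar>
      \<le> (1 + \<eta>) * (\<mu> + 2) / \<alpha> * cycle_resid m * norm (exact_resid (m * N + s))" if s: "s < N" for s
  proof -
    let ?k = "m * N + s"
    define A where "A = F' s (exact ?k)"
    define r where "r = exact_resid ?k"
    define h where "h = update (\<lambda>_. 0) y ?k"
    have r: "r = y s - F s (exact ?k)" using s by (simp add: r_def resid_def)
    have h: "h = lm_step \<alpha> A r" using s by (simp add: h_def A_def r_def update_def)
    have "norm r \<le> cycle_resid m"
      using member_le_sum[of s "{..<N}" "\<lambda>s. norm (exact_resid (m * N + s))"] s
      by (simp add: cycle_resid_def r_def)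
    have "norm (y s - F s (exact (n * N))) \<le> \<mu> * cycle_resid m"
      using norm_resid_cycle_start_le[OF s, of n] mult_left_mono[OF assms \<mu>] by linarith
    then have "norm (F s (exact (n * N)) - F s (exact ?k)) \<le> (\<mu> + 1) * cycle_resid m"
      using \<open>norm r \<le> cycle_resid m\<close> norm_triangle_ineq4[of r "y s - F s (exact (n * N))"]
      by (simp add: r distrib_right)
    then have "norm (A (exact (n * N) - exact ?k)) \<le> (1 + \<eta>) * ((\<mu> + 1) * cycle_resid m)"
      unfolding A_def using eta_pos
      by (intro order_trans[OF norm_linearization_le[OF s exact_in_ball exact_in_ball]] mult_left_mono) auto
    moreover have "norm (A (xstar - exact ?k)) \<le> (1 + \<eta>) * cycle_resid m"
    proof -
      have "F s xstar = y s" using xstar_sol s by (simp add: is_solution_def)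
      then show ?thesis
        unfolding A_def using eta_pos \<open>norm r \<le> cycle_resid m\<close>
        by (intro order_trans[OF norm_linearization_le[OF s exact_in_ball xstar_in_ball]] mult_left_mono)
          (auto simp: r)
    qed
    moreover have "A e = A (exact (n * N) - exact ?k) - A (xstar - exact ?k)"
      by (simp add: e_def blinfun.diff_right)
    then have "norm (A e) \<le> norm (A (exact (n * N) - exact ?k)) + norm (A (xstar - exact ?k))"
      using norm_triangle_ineq4 by metis
    \<comment> \<open>The factor \<open>\<mu> + 2\<close> is \<open>\<mu> + 1\<close> from the cycle
      start at \<open>n\<close> plus 1 from \<open>xstar\<close>.\<close>
    ultimately have Ae: "norm (A e) \<le> (1 + \<eta>) * (\<mu> + 2) * cycle_resid m"
      by (simp add: distrib_left distrib_right)
    have "\<alpha> * \<bar>h \<bullet> e\<bar> = \<bar>(r - A h) \<bullet> A e\<bar>"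
      using inner_lm_step[OF alpha_pos, of A r e] alpha_pos by (metis h abs_mult abs_of_pos)
    also have "\<dots> \<le> norm (r - A h) * norm (A e)"
      by (rule Cauchy_Schwarz_ineq2)
    also have "\<dots> \<le> norm r * ((1 + \<eta>) * (\<mu> + 2) * cycle_resid m)"
      unfolding h using Ae by (intro mult_mono norm_lm_residual_le alpha_pos) auto
    finally show ?thesis
      using alpha_pos by (simp add: h_def r_def field_simps)
  qed
  have "exact (m * N + s) - exact (m * N) = (\<Sum>t<s. update (\<lambda>_. 0) y (m * N + t))" for s
    by (induction s) (auto simp: exact_Suc algebra_simps)
  from this[of N] have "(exact (Suc m * N) - exact (m * N)) \<bullet> e = (\<Sum>s<N. update (\<lambda>_. 0) y (m * N + s) \<bullet> e)"
    by (simp add: add.commute inner_sum_left)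
  also have "\<bar>\<dots>\<bar> \<le> (\<Sum>s<N. (1 + \<eta>) * (\<mu> + 2) / \<alpha> * cycle_resid m * norm (exact_resid (m * N + s)))"
    using step by (intro order_trans[OF sum_abs] sum_mono) auto
  also have "\<dots> = (1 + \<eta>) * (\<mu> + 2) / \<alpha> * (cycle_resid m)\<^sup>2"
    unfolding sum_distrib_left[symmetric] cycle_resid_def[symmetric] by (simp add: power2_eq_square)
  finally show ?thesis by (simp add: e_def)
qed

lemma exact_cycles_converge:
  obtains xplus where "(\<lambda>m. exact (m * N)) \<longlonglongrightarrow> xplus" "xplus \<in> ball x0 \<rho>" "is_solution N D F y xplus"
proof -
  have dec: "decseq (\<lambda>k. norm (exact k - xstar))"
    by (rule decseq_norm_iter_diff[OF admissible_exact xstar_in_ball xstar_sol])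
  then have "decseq (\<lambda>m. norm (exact (m * N) - xstar))"
    by (auto simp: decseq_def)
  moreover have "0 \<le> (1 + \<eta>) * (\<mu> + 2) / \<alpha>"
    using eta_pos C eta_less_1 alpha_pos by (simp add: \<mu>_def)
  ultimately have "Cauchy (\<lambda>m. exact (m * N))"
    by (intro Cauchy_if_increments_bounded_by_minimum[OF _ summable_cycle_resid inner_cycle_increment_le])
  then obtain xplus where lim: "(\<lambda>m. exact (m * N)) \<longlonglongrightarrow> xplus"
    using Cauchy_convergent_iff convergent_def by blast
  have "norm (xplus - xstar) \<le> norm (x0 - xstar)"
    using decseqD[OF dec, of 0] by (intro LIMSEQ_le_const2[OF tendsto_norm[OF tendsto_diff[OF lim tendsto_const]]]) auto
  then have ball: "xplus \<in> ball x0 \<rho>"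
    using dist_triangle[of x0 xplus xstar] xstar_ball by (simp add: dist_norm norm_minus_commute)
  have "(\<lambda>m. sqrt ((cycle_resid m)\<^sup>2)) \<longlonglongrightarrow> sqrt 0"
    by (intro tendsto_real_sqrt summable_LIMSEQ_zero summable_cycle_resid)
  then have "(\<lambda>m. \<mu> * cycle_resid m) \<longlonglongrightarrow> 0"
    using cycle_resid_nonneg by (simp add: tendsto_mult_right_zero)
  then have res0: "(\<lambda>m. y i - F i (exact (m * N))) \<longlonglongrightarrow> 0" if "i < N" for i
    using norm_resid_cycle_start_le[OF that]
    by (rule Lim_null_comparison[OF always_eventually[OF allI], rotated])
  have "F i xplus = y i" if "i < N" for i
  proof -
    have "(\<lambda>m. y i - F i (exact (m * N))) \<longlonglongrightarrow> y i - F i xplus"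
      by (intro tendsto_intros tendsto_F that lim ball)
    from LIMSEQ_unique[OF this res0[OF that]] show ?thesis by simp
  qed
  then have "is_solution N D F y xplus"
    using ball ball_in_D by (simp add: is_solution_def)
  then show ?thesis using that lim ball by blast
qed

subsection \<open>Stability\<close>

text \<open>The switch between the two branches of the iteration is harmless in the limit: whenever a step is
  skipped the residual is below \<open>\<tau> \<delta>\<close>, hence so is the skipped update, up to a constant.\<close>

lemma iter_tendsto_exact:
  assumes adm: "\<And>j. admissible (\<delta> j) (yd j)"
    and \<delta>: "\<And>i. i < N \<Longrightarrow> (\<lambda>j. \<delta> j i) \<longlonglongrightarrow> 0"
  shows "(\<lambda>j. iter (\<delta> j) (yd j) k) \<longlonglongrightarrow> exact k"
proof (induction k)
  case (Suc k)
  define i where "i = k mod N"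
  have i: "i < N" using mod_less by (simp add: i_def)
  have "(\<lambda>j. yd j i - y i) \<longlonglongrightarrow> 0"
    using adm i by (intro Lim_null_comparison[OF always_eventually \<delta>[OF i]]) (auto simp: admissible_def)
  then have "(\<lambda>j. yd j i) \<longlonglongrightarrow> y i"
    by (rule Lim_null[THEN iffD2])
  then have res: "(\<lambda>j. resid (\<delta> j) (yd j) k) \<longlonglongrightarrow> exact_resid k"
    unfolding resid_def i_def[symmetric]
    by (intro tendsto_diff tendsto_F i Suc exact_in_ball)
  then have upd: "(\<lambda>j. update (\<delta> j) (yd j) k) \<longlonglongrightarrow> update (\<lambda>_. 0) y k"
    unfolding update_def i_def[symmetric]
    by (intro tendsto_lm_step alpha_pos tendsto_F i Suc exact_in_ball)
  \<comment> \<open>\<open>g\<close> is the skipped update, so the true iteration is the one that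
    always updates, corrected by \<open>g\<close>.\<close>
  define g where "g j = (if active (\<delta> j) (yd j) k then 0 else update (\<delta> j) (yd j) k)" for j
  have "norm (g j) \<le> C / \<alpha> * (\<tau> * \<delta> j i)" for j
  proof (cases "active (\<delta> j) (yd j) k")
    case True
    then show ?thesis
      using adm[of j] i C alpha_pos tau_pos by (simp add: g_def admissible_def)
  next
    case False
    then have "norm (resid (\<delta> j) (yd j) k) \<le> \<tau> * \<delta> j i"
      by (simp add: active_def i_def)
    then have "C / \<alpha> * norm (resid (\<delta> j) (yd j) k) \<le> C / \<alpha> * (\<tau> * \<delta> j i)"
      using C alpha_pos by (intro mult_left_mono) auto
    then show ?thesis
      using False order_trans[OF norm_update_le[OF iter_in_ball[OF adm]]] by (simp add: g_def)
  qed
  moreover have "(\<lambda>j. C / \<alpha> * (\<tau> * \<delta> j i)) \<longlonglongrightarrow> 0"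
    by (intro tendsto_mult_right_zero \<delta> i)
  ultimately have "g \<longlonglongrightarrow> 0"
    by (rule Lim_null_comparison[OF always_eventually[OF allI]])
  then have "(\<lambda>j. iter (\<delta> j) (yd j) k + update (\<delta> j) (yd j) k - g j) \<longlonglongrightarrow>
      exact k + update (\<lambda>_. 0) y k - 0"
    by (intro tendsto_intros Suc upd)
  moreover have "iter (\<delta> j) (yd j) k + update (\<delta> j) (yd j) k - g j = iter (\<delta> j) (yd j) (Suc k)" for j
    by (simp add: g_def iter_Suc)
  ultimately show ?case by (simp add: exact_Suc)
qed simp

text \<open>Monotonicity towards the solution \<open>exact (l * N)\<close> itself: the distance is
  zero at index \<open>l * N\<close> and cannot grow.\<close>

lemma exact_stationary:
  assumes "is_solution N D F y (exact (l * N))"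
  shows "exact (l * N + m) = exact (l * N)"
proof -
  have "decseq (\<lambda>k. norm (exact k - exact (l * N)))"
    by (rule decseq_norm_iter_diff[OF admissible_exact exact_in_ball assms])
  from decseqD[OF this, of "l * N" "l * N + m"] show ?thesis by simp
qed

lemma stopped_iter_tendsto:
  assumes adm: "\<And>j. admissible (\<delta> j) (yd j)"
    and pos: "\<And>j i. i < N \<Longrightarrow> 0 < \<delta> j i"
    and \<delta>: "\<And>i. i < N \<Longrightarrow> (\<lambda>j. \<delta> j i) \<longlonglongrightarrow> 0"
    and lim: "(\<lambda>m. exact (m * N)) \<longlonglongrightarrow> xplus" and ball: "xplus \<in> ball x0 \<rho>"
    and sol: "is_solution N D F y xplus"
  shows "(\<lambda>j. iter (\<delta> j) (yd j) (stopping_index N (iter (\<delta> j) (yd j)))) \<longlonglongrightarrow> xplus"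
proof (rule tendstoI)
  fix e :: real
  assume "0 < e"
  let ?x = "\<lambda>j. iter (\<delta> j) (yd j)"
  have "\<exists>l. stopping_index N (?x j) = l * N \<and>
      (\<forall>i<N. norm (yd j i - F i (?x j (l * N))) < \<tau> * \<delta> j i)" for j
    by (rule stopping_index_works[OF adm pos, of j]) auto
  then obtain L where L: "\<And>j. stopping_index N (?x j) = L j * N"
    and small: "\<And>j i. i < N \<Longrightarrow> norm (yd j i - F i (?x j (L j * N))) < \<tau> * \<delta> j i"
    by metis
  have stab: "(\<lambda>j. ?x j k) \<longlonglongrightarrow> exact k" for k
    by (rule iter_tendsto_exact[OF adm \<delta>])
  \<comment> \<open>The cycle \<open>M\<close> depends only on \<open>e\<close>; stopping cycles
    from \<open>M\<close> on are treated together, the finitely many earlier ones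
    individually.\<close>
  obtain M where M: "dist (exact (M * N)) xplus < e"
    using tendstoD[OF lim \<open>0 < e\<close>] by (auto simp: eventually_sequentially)
  have late: "\<forall>\<^sub>F j in sequentially. M \<le> L j \<longrightarrow> dist (?x j (L j * N)) xplus < e"
  proof -
    have "(\<lambda>j. dist (?x j (M * N)) xplus) \<longlonglongrightarrow> dist (exact (M * N)) xplus"
      by (intro tendsto_intros stab)
    from order_tendstoD(2)[OF this M] show ?thesis
    proof eventually_elim
      case (elim j)
      show ?case
        using decseqD[OF decseq_norm_iter_diff[OF adm[of j] ball sol], of "M * N" "L j * N"] elim
        by (auto simp: dist_norm)
    qed
  qed
  have early: "\<forall>\<^sub>F j in sequentially. L j = l \<longrightarrow> dist (?x j (L j * N)) xplus < e" for l
  proof (cases "is_solution N D F y (exact (l * N))")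
    case True
    have "exact (m * N) = exact (l * N)" if "m \<ge> l" for m
      using exact_stationary[OF True, of "(m - l) * N"] that by (simp add: diff_mult_distrib)
    then have "(\<lambda>m. exact (m * N)) \<longlonglongrightarrow> exact (l * N)"
      by (intro tendsto_eventually eventually_sequentiallyI[of l])
    then have "exact (l * N) = xplus" using lim LIMSEQ_unique by blast
    with stab[of "l * N"] have "\<forall>\<^sub>F j in sequentially. dist (?x j (l * N)) xplus < e"
      using \<open>0 < e\<close> tendstoD by blast
    then show ?thesis by eventually_elim auto
  next
    case False
    then obtain i where i: "i < N" "F i (exact (l * N)) \<noteq> y i"
      using ball_in_D exact_in_ball unfolding is_solution_def by blast
    \<comment> \<open>Stopping at \<open>l * N\<close> would force the exact-data residual below
      \<open>\<delta> j i + \<tau> * \<delta> j i\<close>, which tends to zero, while the residual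
      tends to a positive limit. So this stopping index eventually does not occur.\<close>
    have "(\<lambda>j. norm (y i - F i (?x j (l * N))) - (\<delta> j i + \<tau> * \<delta> j i)) \<longlonglongrightarrow>
        norm (y i - F i (exact (l * N))) - (0 + \<tau> * 0)"
      by (intro tendsto_intros tendsto_F stab exact_in_ball \<delta> i)
    moreover have "0 < norm (y i - F i (exact (l * N))) - (0 + \<tau> * 0)"
      using i by simp
    ultimately have "\<forall>\<^sub>F j in sequentially. 0 < norm (y i - F i (?x j (l * N))) - (\<delta> j i + \<tau> * \<delta> j i)"
      by (rule order_tendstoD(1))
    then show ?thesis
    proof eventually_elim
      case (elim j)
      have "L j \<noteq> l"
      proof
        assume "L j = l"
        moreover have "norm (yd j i - y i) \<le> \<delta> j i"
          using adm i(1) by (auto simp: admissible_def)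
        ultimately show False
          using elim small[OF i(1), of j]
            norm_triangle_ineq4[of "yd j i - F i (?x j (l * N))" "yd j i - y i"] by simp
      qed
      then show ?case by simp
    qed
  qed
  have "\<forall>\<^sub>F j in sequentially. \<forall>l\<in>{..<M}. L j = l \<longrightarrow> dist (?x j (L j * N)) xplus < e"
    by (rule eventually_ball_finite) (use early in auto)
  with late show "\<forall>\<^sub>F j in sequentially. dist (?x j (stopping_index N (?x j))) xplus < e"
    unfolding L
  proof eventually_elim
    case (elim j)
    then show ?case by (cases "M \<le> L j") auto
  qed
qed

subsection \<open>The minimal norm solution\<close>

lemma linearization_eq_0_if_solutions:
  assumes "i < N" "u \<in> ball x0 \<rho>" "v \<in> ball x0 \<rho>" "F i u = F i v"
  shows "F' i u (v - u) = 0"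
  using tcc[OF assms(1-3)] unfolding assms(4) by simp

text \<open>With a vanishing linear term the cone condition bounds the difference by
  \<open>\<eta> < 1\<close> times itself. Hence moving from a solution along the joint null space,
  within the ball, yields further solutions.\<close>

lemma F_eq_if_linearization_eq_0:
  assumes "i < N" "u \<in> ball x0 \<rho>" "v \<in> ball x0 \<rho>" "F' i u (v - u) = 0"
  shows "F i v = F i u"
proof -
  have "(1 - \<eta>) * norm (F i v - F i u) \<le> 0"
    using tcc[OF assms(1-3)] assms(4) by (simp add: algebra_simps)
  then show ?thesis
    using eta_less_1 by (simp add: mult_le_0_iff)
qed

text \<open>Each update lies in the range of an adjoint, so it is orthogonal to any vector killed by
  all linearizations in the ball.\<close>

lemma exact_diff_orthogonal:
  assumes "\<And>z i. z \<in> ball x0 \<rho> \<Longrightarrow> i < N \<Longrightarrow> F' i z v = 0"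
  shows "(exact k - x0) \<bullet> v = 0"
proof (induction k)
  case (Suc k)
  have "update (\<lambda>_. 0) y k \<bullet> v = 0"
    using inner_lm_step[OF alpha_pos, of "F' (k mod N) (exact k)" "exact_resid k" v]
      assms[OF exact_in_ball mod_less] alpha_pos
    by (simp add: update_def)
  then show ?case using Suc by (simp add: exact_Suc inner_diff_left inner_add_left)
qed simp

text \<open>A short segment through \<open>xdag\<close> in direction \<open>v\<close> consists of
  solutions in the half ball, so the squared distance to \<open>x0\<close> has a minimum at
  \<open>xdag\<close> along it and its derivative vanishes.\<close>

lemma min_norm_solution_orthogonal:
  assumes xdag: "is_min_norm_solution N D F y x0 \<rho> xdag"
    and v: "v \<in> joint_null_space N (\<lambda>i. F' i xdag)"
  shows "(xdag - x0) \<bullet> v = 0"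
proof -
  let ?S = "{z \<in> ball x0 (\<rho>/2). is_solution N D F y z}"
  have xdag': "xdag \<in> ball x0 (\<rho>/2)" "is_solution N D F y xdag"
    and min: "norm (xdag - x0) = (INF z\<in>?S. norm (z - x0))"
    using xdag by (auto simp: is_min_norm_solution_def)
  \<comment> \<open>Scaling by \<open>s\<close> keeps
    \<open>xdag + t *\<^sub>R (s *\<^sub>R v)\<close> in the open ball for
    \<open>\<bar>t\<bar> < 1\<close>; the added 1 covers \<open>v = 0\<close>.\<close>
  define s where "s = (\<rho>/2 - dist x0 xdag) / (norm v + 1)"
  have s: "0 < s" using xdag'(1) by (simp add: s_def add_nonneg_pos)
  have sv: "s * norm v < \<rho>/2 - dist x0 xdag"
  proof -
    have "s * norm v < s * (norm v + 1)"
      using s by simp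
    also have "\<dots> = \<rho>/2 - dist x0 xdag"
      using norm_ge_zero[of v] by (simp add: s_def add_nonneg_eq_0_iff)
    finally show ?thesis .
  qed
  have "0 \<le> 2 * ((xdag - x0) \<bullet> (s *\<^sub>R v)) * t + (s *\<^sub>R v) \<bullet> (s *\<^sub>R v) * t\<^sup>2" if t: "\<bar>t\<bar> < 1" for t
  proof -
    define w where "w = xdag + t *\<^sub>R (s *\<^sub>R v)"
    have "norm (t *\<^sub>R (s *\<^sub>R v)) = \<bar>t\<bar> * (s * norm v)"
      using s by (simp add: abs_mult)
    also have "\<dots> \<le> 1 * (s * norm v)"
      using t s by (intro mult_right_mono) auto
    finally have "norm (t *\<^sub>R (s *\<^sub>R v)) \<le> s * norm v"
      by simp
    then have w: "w \<in> ball x0 (\<rho>/2)"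
      using sv dist_triangle[of x0 w xdag] by (simp add: w_def dist_norm)
    have "F i w = y i" if "i < N" for i
    proof -
      have "F' i xdag (w - xdag) = 0"
        using v that by (simp add: w_def joint_null_space_def blinfun.scaleR_right)
      then have "F i w = F i xdag"
        using w xdag'(1) rho by (intro F_eq_if_linearization_eq_0 that) auto
      then show ?thesis using xdag'(2) that by (simp add: is_solution_def)
    qed
    moreover have "w \<in> ball x0 \<rho>"
      using w rho by simp
    ultimately have "w \<in> ?S"
      using w ball_in_D by (simp add: is_solution_def)
    then have "norm (xdag - x0) \<le> norm (w - x0)"
      unfolding min by (intro cINF_lower bdd_belowI[of _ 0]) auto
    then have "(norm (xdag - x0))\<^sup>2 \<le> (norm (w - x0))\<^sup>2"
      by (intro power_mono) auto
    then show ?thesis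
      unfolding w_def power2_norm_eq_inner by (simp add: algebra_simps inner_commute power2_eq_square)
  qed
  from linear_coeff_eq_0_if_quadratic_nonneg[OF this] show ?thesis
    using s by simp
qed

lemma limit_eq_min_norm_solution:
  assumes lim: "(\<lambda>m. exact (m * N)) \<longlonglongrightarrow> xplus" and ball: "xplus \<in> ball x0 \<rho>"
    and sol: "is_solution N D F y xplus"
    and xdag: "is_min_norm_solution N D F y x0 \<rho> xdag"
    and null: "\<And>z. z \<in> ball x0 \<rho> \<Longrightarrow> joint_null_space N (\<lambda>i. F' i xdag) \<subseteq> joint_null_space N (\<lambda>i. F' i z)"
  shows "xplus = xdag"
proof -
  define v where "v = xplus - xdag"
  have "xdag \<in> ball x0 \<rho>" "is_solution N D F y xdag"
    using xdag rho by (auto simp: is_min_norm_solution_def)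
  then have v: "v \<in> joint_null_space N (\<lambda>i. F' i xdag)"
    using sol ball linearization_eq_0_if_solutions
    by (auto simp: joint_null_space_def v_def is_solution_def)
  \<comment> \<open>The inclusion of null spaces is used here: \<open>v\<close> is annihilated at
    \<open>xdag\<close>, hence at every point of the ball, in particular at all iterates.\<close>
  then have "(exact (m * N) - x0) \<bullet> v = 0" for m
    using null by (intro exact_diff_orthogonal) (auto simp: joint_null_space_def)
  moreover have "(\<lambda>m. (exact (m * N) - x0) \<bullet> v) \<longlonglongrightarrow> (xplus - x0) \<bullet> v"
    by (intro tendsto_intros lim)
  ultimately have "(xplus - x0) \<bullet> v = 0"
    by (simp add: LIMSEQ_const_iff)
  moreover have "(xdag - x0) \<bullet> v = 0"
    by (rule min_norm_solution_orthogonal[OF xdag v])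
  ultimately have "v \<bullet> v = 0"
    by (simp add: v_def algebra_simps)
  then show ?thesis by (simp add: v_def)
qed

end

theorem theorem4p3:
  fixes N :: nat
    and D :: "nat \<Rightarrow> 'a::{real_inner, complete_space} set"
    and F :: "nat \<Rightarrow> 'a \<Rightarrow> 'b::{real_inner, complete_space}"
    and F' :: "nat \<Rightarrow> 'a \<Rightarrow> 'a \<Rightarrow>\<^sub>L 'b"
    and y :: "nat \<Rightarrow> 'b"
    and x0 xstar :: 'a
    and \<rho> C \<eta> \<alpha> \<tau> q :: real
    and \<delta> :: "nat \<Rightarrow> nat \<Rightarrow> real"
    and yd :: "nat \<Rightarrow> nat \<Rightarrow> 'b"
  assumes "N \<ge> 1"
    and "\<rho> > 0"
    and "\<And>i. i < N \<Longrightarrow> ball x0 \<rho> \<subseteq> D i"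
    and "\<And>i. i < N \<Longrightarrow> continuous_on (D i) (F i)"
    and "\<And>i. i < N \<Longrightarrow> continuous_on (D i) (F' i)"
    and "C > 0"
    and "\<And>i x. i < N \<Longrightarrow> x \<in> ball x0 \<rho> \<Longrightarrow> norm (F' i x) \<le> C"
    and "\<eta> < 1"
    and "\<And>i x xb. i < N \<Longrightarrow> x \<in> ball x0 \<rho> \<Longrightarrow> xb \<in> ball x0 \<rho> \<Longrightarrow>
           norm (F i xb - F i x - blinfun_apply (F' i x) (xb - x)) \<le> \<eta> * norm (F i xb - F i x)"
    and "xstar \<in> ball x0 (\<rho>/2)"
    and "is_solution N D F y xstar"
    and "0 < q" and "q < 1"
    and "\<alpha> > C\<^sup>2 * q / (1 - q)"
    and "\<tau> > (1 + \<eta>) / (1 - \<eta>)"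
    and "(1 + \<eta>) / (1 - \<eta>) > 1"
    and "\<eta> + (1 + \<eta>) * inverse \<tau> < q"
    and "\<And>j i. i < N \<Longrightarrow> \<delta> j i > 0"
    and "\<And>i. i < N \<Longrightarrow> (\<lambda>j. \<delta> j i) \<longlonglongrightarrow> 0"
    and "\<And>j i. i < N \<Longrightarrow> norm (yd j i - y i) \<le> \<delta> j i"
  defines "x \<equiv> \<lambda>j. lmk_iterate N F F' \<alpha> \<tau> x0 (\<delta> j) (yd j)"
  defines "kstar \<equiv> \<lambda>j. stopping_index N (x j)"
  shows "(\<exists>xplus. is_solution N D F y xplus \<and> (\<lambda>j. x j (kstar j)) \<longlonglongrightarrow> xplus) \<and>
    (\<forall>xdag. is_min_norm_solution N D F y x0 \<rho> xdag \<longrightarrow>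
      (\<forall>z\<in>ball x0 \<rho>. joint_null_space N (\<lambda>i. F' i xdag) \<subseteq> joint_null_space N (\<lambda>i. F' i z)) \<longrightarrow>
      (\<lambda>j. x j (kstar j)) \<longlonglongrightarrow> xdag)"
proof -
  interpret lmk_setting N D F F' y x0 xstar \<rho> C \<eta> \<alpha> \<tau> q
    by (intro lmk_setting.intro assms(1-17))
  have adm: "admissible (\<delta> j) (yd j)" for j
    using assms(18,20) by (auto simp: admissible_def intro: less_imp_le)
  obtain xplus where xplus: "(\<lambda>m. exact (m * N)) \<longlonglongrightarrow> xplus" "xplus \<in> ball x0 \<rho>" "is_solution N D F y xplus"
    by (rule exact_cycles_converge)
  have "(\<lambda>j. x j (kstar j)) \<longlonglongrightarrow> xplus"
    unfolding x_def kstar_def by (rule stopped_iter_tendsto[OF adm assms(18,19) xplus])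
  then show ?thesis
    using xplus limit_eq_min_norm_solution[OF xplus] by blast
qed

end
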